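(* Let $a<b$ be real numbers. For all concave functions $w:[a,b]\to[0,\infty)$ (continuous on $[a,b]$) and for all real-valued functions $f\in C^2[a,b]$ with $f(a)=f(b)=0$ we have $$\left(\int_a^b w(x) f'(x)^2\,dx\right)^2\le \left(\int_a^b w(x) f(x)^2\,dx\right)\left(\int_a^b w(x) f''(x)^2\,dx\right).$$ Moreover, let $w\not\equiv 0$ and $f\not\equiv 0$. Then equality holds in this inequality if and only if there exist a real number $\lambda$ and a natural number $n\ge 1$ such that $$f(x)=\lambda\sin\left(\frac{n\pi(x-a)}{b-a}\right)\quad\text{for all } x\in[a,b],$$ and $w$ is linear in each of the subintervals $$J_k=\left[a+\frac{(k-1)(b-a)}{n},\ a+\frac{k(b-a)}{n}\right],\qquad k=1,\dots,n.$$
   Context: A function $w:[a,b]\to\mathbf R$ is concave if $\lambda w(x)+(1-\lambda)w(y)\le w(\lambda x+(1-\lambda)y)$ for all $x,y\in[a,b]$ and $\lambda\in(0,1)$. A concave function on $[a,b]$ is continuous on $(a,b)$ and has finite one-sided limits at $a$ and $b$; by convention, its endpoint values are taken to be these limits, so that concave functions are continuous on $[a,b]$. "Linear" on an interval means affine, i.e. of the form $x\mapsto \alpha x+\beta$ with real constants $\alpha,\beta$ (which may depend on the subinterval). *)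

theory Defs
  imports "HOL-Analysis.Analysis"
begin

text \<open>``Linear'' on an interval in the sense of affine; the library predicate \<open>linear\<close> would
  force the constant term to vanish.\<close>

definition affine_fun_on :: "real set \<Rightarrow> (real \<Rightarrow> real) \<Rightarrow> bool" where
  "affine_fun_on S w \<longleftrightarrow> (\<exists>\<alpha> \<beta>. \<forall>x\<in>S. w x = \<alpha> * x + \<beta>)"

text \<open>\<open>C\<^sup>2[a,b]\<close>, with \<open>f'\<close> and \<open>f''\<close> the first and second derivative on \<open>[a,b]\<close>. At the endpoints
  these are the one-sided derivatives. For \<open>a < b\<close> both are determined by \<open>f\<close> on \<open>[a,b]\<close>.\<close>

definition C2_with_derivs ::
    "real \<Rightarrow> real \<Rightarrow> (real \<Rightarrow> real) \<Rightarrow> (real \<Rightarrow> real) \<Rightarrow> (real \<Rightarrow> real) \<Rightarrow> bool" where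
  "C2_with_derivs a b f f' f'' \<longleftrightarrow>
     (\<forall>x\<in>{a..b}. (f has_real_derivative f' x) (at x within {a..b})) \<and>
     (\<forall>x\<in>{a..b}. (f' has_real_derivative f'' x) (at x within {a..b})) \<and>
     continuous_on {a..b} f''"

end

(* Put h = f^2. Then int w f'^2 + int w f f'' = (1/2) int w h'', and formally int w h'' = int w'' h <= 0
   since w is concave. This sign is obtained without differentiating w, from Riemann sums and summation by
   parts of second differences; Cauchy-Schwarz then gives the inequality.
   Equality forces f'' = -t f, so f is a sine, and int w h'' = 0. On an interval J between consecutive
   zeros of f, h dominates a positive multiple k g of a C^2 bump g supported on J, and the sign result
   applied to h - k g gives int w g'' >= 0. The function g'' changes sign exactly twice in J and is orthogonal
   to affine functions; after subtracting from w its chord through these two points the integrand has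
   constant sign, so w equals that chord on J. *)
theory Submission
  imports Defs
begin

section \<open>Summation by parts, chord inequalities and mean values of second differences\<close>

text \<open>Discrete form of integrating by parts twice. When \<open>h\<close> vanishes at the
  indices \<open>0\<close> and \<open>Suc n\<close>, only the boundary terms with \<open>h n\<close>
  and \<open>h 1\<close> survive, both with a minus sign.\<close>

lemma sum_second_difference_by_parts:
  fixes w h :: "nat \<Rightarrow> 'a::comm_ring_1"
  shows "(\<Sum>i<n. w (Suc i) * (h (i + 2) - 2 * h (Suc i) + h i))
       = (\<Sum>i<n. h (Suc i) * (w (i + 2) - 2 * w (Suc i) + w i))
         + w n * h (Suc n) - w (Suc n) * h n - w 0 * h 1 + w 1 * h 0"
  by (induction n) (simp_all add: algebra_simps)

lemma integral_sum_consecutive: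
  fixes g :: "real \<Rightarrow> 'a::banach" and x :: "nat \<Rightarrow> real"
  assumes "mono x" "g integrable_on {x 0..x n}"
  shows "integral {x 0..x n} g = (\<Sum>i<n. integral {x i..x (Suc i)} g)"
  using assms(2)
proof (induction n)
  case (Suc n)
  have le: "x 0 \<le> x n" "x n \<le> x (Suc n)"
    using assms(1) by (simp_all add: monoD)
  have "g integrable_on {x 0..x n}"
    using integrable_on_subinterval[OF Suc.prems] le by auto
  with Suc.IH Henstock_Kurzweil_Integration.integral_combine[OF le Suc.prems] show ?case
    by simp
qed simp

text \<open>The chord inequality with its denominator \<open>z - x\<close> cleared, so that
  coinciding points are allowed and later uses stay free of division.\<close>

lemma concave_on_three_points:
  fixes w :: "real \<Rightarrow> real"
  assumes "concave_on S w" "x \<in> S" "z \<in> S" "x \<le> y" "y \<le> z"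
  shows "(z - y) * w x + (y - x) * w z \<le> (z - x) * w y"
proof (cases "x = z")
  case False
  with assms have "x < z" by simp
  define t where "t = (y - x) / (z - x)"
  have t: "0 \<le> t" "t \<le> 1" and zt: "(z - x) * t = y - x"
    using assms \<open>x < z\<close> by (auto simp: t_def field_simps)
  have y: "(1 - t) *\<^sub>R x + t *\<^sub>R z = y"
    using \<open>x < z\<close> by (simp add: t_def divide_simps) (simp add: algebra_simps)
  have "(1 - t) * w x + t * w z \<le> w y"
    using concave_onD[OF assms(1) t(1,2) assms(2,3)] y by simp
  then have "(z - x) * ((1 - t) * w x + t * w z) \<le> (z - x) * w y"
    using \<open>x < z\<close> by (intro mult_left_mono) auto
  moreover have "(z - x) * ((1 - t) * w x + t * w z) = (z - x - (z - x) * t) * w x + (z - x) * t * w z"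
    by (simp add: algebra_simps)
  ultimately show ?thesis
    unfolding zt by simp
qed (use assms in auto)

lemma has_real_derivative_MVT_within:
  fixes f f' :: "real \<Rightarrow> real"
  assumes "a < b" "\<And>x. x \<in> {a..b} \<Longrightarrow> (f has_real_derivative f' x) (at x within {a..b})"
  obtains z where "a < z" "z < b" "f b - f a = (b - a) * f' z"
proof -
  have "\<exists>z\<in>{a<..<b}. f b - f a = f' z * (b - a)"
    using assms by (intro mvt_simple) (auto simp: has_field_derivative_def)
  then show thesis
    using that by (auto simp: mult.commute)
qed

text \<open>The mean value theorem is applied twice: to the increment \<open>h (t + d) - h t\<close>
  on \<open>{x - d..x}\<close>, then to \<open>h'\<close> on an interval of length \<open>d\<close>.
  Derivatives within the interval suffice, so the stencil may touch the endpoints of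
  \<open>{a..b}\<close>.\<close>

lemma second_difference_mean_value:
  fixes h h' h'' :: "real \<Rightarrow> real"
  assumes "0 < d"
    and h: "\<And>t. t \<in> {x - d..x + d} \<Longrightarrow> (h has_real_derivative h' t) (at t within {x - d..x + d})"
    and h': "\<And>t. t \<in> {x - d..x + d} \<Longrightarrow> (h' has_real_derivative h'' t) (at t within {x - d..x + d})"
  obtains \<xi> where "x - d < \<xi>" "\<xi> < x + d" "h (x + d) - 2 * h x + h (x - d) = d\<^sup>2 * h'' \<xi>"
proof -
  have D: "((\<lambda>t. h (t + d) - h t) has_real_derivative h' (t + d) - h' t) (at t within {x - d..x})"
    if "t \<in> {x - d..x}" for t
  proof -
    have "(h has_real_derivative h' (t + d)) (at (t + d) within (\<lambda>t. t + d) ` {x - d..x})"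
      using that \<open>0 < d\<close> by (intro DERIV_subset[OF h]) auto
    moreover have "((\<lambda>t. t + d) has_real_derivative 1) (at t within {x - d..x})"
      by (auto intro!: derivative_eq_intros)
    ultimately have "(h \<circ> (\<lambda>t. t + d) has_real_derivative h' (t + d) * 1) (at t within {x - d..x})"
      by (rule DERIV_image_chain)
    then have 1: "((\<lambda>t. h (t + d)) has_real_derivative h' (t + d)) (at t within {x - d..x})"
      by (simp add: o_def)
    have "(h has_real_derivative h' t) (at t within {x - d..x})"
      using that \<open>0 < d\<close> by (intro DERIV_subset[OF h]) auto
    with 1 show ?thesis
      by (rule DERIV_diff)
  qed
  have lt: "x - d < x"
    using \<open>0 < d\<close> by simp
  obtain \<eta> where \<eta>: "x - d < \<eta>" "\<eta> < x"
    and eq: "(h (x + d) - h x) - (h (x - d + d) - h (x - d)) = (x - (x - d)) * (h' (\<eta> + d) - h' \<eta>)"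
    by (rule has_real_derivative_MVT_within[OF lt D])
  have D': "(h' has_real_derivative h'' t) (at t within {\<eta>..\<eta> + d})" if "t \<in> {\<eta>..\<eta> + d}" for t
    using that \<eta> by (intro DERIV_subset[OF h']) auto
  have lt': "\<eta> < \<eta> + d"
    using \<open>0 < d\<close> by simp
  obtain \<xi> where \<xi>: "\<eta> < \<xi>" "\<xi> < \<eta> + d" "h' (\<eta> + d) - h' \<eta> = (\<eta> + d - \<eta>) * h'' \<xi>"
    by (rule has_real_derivative_MVT_within[OF lt' D'])
  have "h (x + d) - 2 * h x + h (x - d) = d\<^sup>2 * h'' \<xi>"
    using eq \<xi>(3) by (simp add: power2_eq_square)
  then show thesis
    using that[of \<xi>] \<eta> \<xi> by simp
qed

section \<open>The sign of the integral of a concave function against a second derivative\<close>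

lemma C2_with_derivsD:
  assumes "C2_with_derivs a b f f' f''"
  shows "x \<in> {a..b} \<Longrightarrow> (f has_real_derivative f' x) (at x within {a..b})"
    and "x \<in> {a..b} \<Longrightarrow> (f' has_real_derivative f'' x) (at x within {a..b})"
    and "continuous_on {a..b} f" "continuous_on {a..b} f'" "continuous_on {a..b} f''"
  using assms unfolding C2_with_derivs_def by (auto intro: DERIV_continuous_on)

text \<open>On a fine uniform grid the integral is, up to a small error, the sum of \<open>w\<close>
  times second differences of \<open>h\<close>, divided by the mesh. Summation by parts moves the
  differences to \<open>w\<close>, where concavity makes them nonpositive.\<close>

lemma integral_concave_times_second_derivative_nonpos:
  fixes w h h' h'' :: "real \<Rightarrow> real"
  assumes "a < b"
    and w: "concave_on {a..b} w" "continuous_on {a..b} w" "\<And>x. x \<in> {a..b} \<Longrightarrow> 0 \<le> w x"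
    and h: "C2_with_derivs a b h h' h''" "\<And>x. x \<in> {a..b} \<Longrightarrow> 0 \<le> h x" "h a = 0" "h b = 0"
  shows "integral {a..b} (\<lambda>x. w x * h'' x) \<le> 0"
proof -
  define g where "g = (\<lambda>x. w x * h'' x)"
  have contg: "continuous_on {a..b} g"
    unfolding g_def using C2_with_derivsD[OF h(1)] w by (intro continuous_intros) auto
  have bdd: "\<exists>M\<ge>0. \<forall>x\<in>{a..b}. \<bar>u x\<bar> \<le> M" if "continuous_on {a..b} u" for u :: "real \<Rightarrow> real"
  proof -
    have "bounded (u ` {a..b})"
      using that by (intro compact_imp_bounded compact_continuous_image) auto
    then show ?thesis
      by (auto simp: bounded_pos intro: less_imp_le)
  qed
  obtain M where M: "M \<ge> 0" "\<And>x. x \<in> {a..b} \<Longrightarrow> \<bar>w x\<bar> \<le> M"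
    using bdd[OF w(2)] by blast
  obtain G where G: "G \<ge> 0" "\<And>x. x \<in> {a..b} \<Longrightarrow> \<bar>g x\<bar> \<le> G"
    using bdd[OF contg] by blast
  have unif: "\<exists>\<delta>>0. \<forall>x\<in>{a..b}. \<forall>y\<in>{a..b}. \<bar>y - x\<bar> < \<delta> \<longrightarrow> \<bar>u y - u x\<bar> < e"
    if "continuous_on {a..b} u" "e > 0" for u :: "real \<Rightarrow> real" and e
    using compact_uniformly_continuous[OF that(1)] that(2)
    unfolding uniformly_continuous_on_def dist_real_def by auto
  have "integral {a..b} g \<le> e * (1 + (1 + M) * (b - a))" if "e > 0" for e
  proof -
    obtain \<delta>1 where \<delta>1: "\<delta>1 > 0"
      "\<And>x y. x \<in> {a..b} \<Longrightarrow> y \<in> {a..b} \<Longrightarrow> \<bar>y - x\<bar> < \<delta>1 \<Longrightarrow> \<bar>g y - g x\<bar> < e"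
      using unif[OF contg \<open>e > 0\<close>] by blast
    obtain \<delta>2 where \<delta>2: "\<delta>2 > 0"
      "\<And>x y. x \<in> {a..b} \<Longrightarrow> y \<in> {a..b} \<Longrightarrow> \<bar>y - x\<bar> < \<delta>2 \<Longrightarrow> \<bar>h'' y - h'' x\<bar> < e"
      using unif[OF C2_with_derivsD(5)[OF h(1)] \<open>e > 0\<close>] by blast
    define \<delta> where "\<delta> = min \<delta>1 \<delta>2"
    have \<delta>: "\<delta> > 0"
      "\<And>x y. x \<in> {a..b} \<Longrightarrow> y \<in> {a..b} \<Longrightarrow> \<bar>y - x\<bar> < \<delta> \<Longrightarrow> \<bar>g y - g x\<bar> < e"
      "\<And>x y. x \<in> {a..b} \<Longrightarrow> y \<in> {a..b} \<Longrightarrow> \<bar>y - x\<bar> < \<delta> \<Longrightarrow> \<bar>h'' y - h'' x\<bar> < e"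
      using \<delta>1 \<delta>2 by (simp_all add: \<delta>_def)
    \<comment> \<open>One choice of \<open>n\<close> serves two purposes: the mesh falls below the
      modulus of continuity \<open>\<delta>\<close>, and a single cell contributes less than
      \<open>e\<close>.\<close>
    obtain n :: nat where n: "(b - a) / \<delta> + (b - a) * G / e < real n"
      using reals_Archimedean2 by blast
    define d where "d = (b - a) / real (Suc n)"
    have "d > 0"
      using \<open>a < b\<close> by (simp add: d_def)
    have pos: "(b - a) / \<delta> \<ge> 0" "(b - a) * G / e \<ge> 0"
      using \<open>a < b\<close> \<delta>(1) G(1) \<open>e > 0\<close> by auto
    have "(b - a) / \<delta> < real (Suc n)" "(b - a) * G / e < real (Suc n)"
      using n pos by linarith+
    then have d: "d < \<delta>" "d * G < e"
      using \<delta>(1) \<open>e > 0\<close> by (simp_all add: d_def divide_simps mult.commute)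
    define x where "x i = a + real i * d" for i
    have "mono x"
      using \<open>d > 0\<close> by (auto simp: mono_def x_def)
    have x0: "x 0 = a" and xn: "x (Suc n) = b"
      by (simp_all add: x_def d_def)
    have x_in: "x i \<in> {a..b}" if "i \<le> Suc n" for i
      using monoD[OF \<open>mono x\<close>, of 0 i] monoD[OF \<open>mono x\<close>, of i "Suc n"] that x0 xn by auto
    have xS: "x (Suc i) = x i + d" "x (i + 2) = x i + d + d" for i
      by (simp_all add: x_def algebra_simps)
    have int_g: "g integrable_on {u..v}" if "u \<in> {a..b}" "v \<in> {a..b}" for u v
      using that by (intro integrable_continuous_real continuous_on_subset[OF contg]) auto
    \<comment> \<open>Each cell is paired with the second difference centred at its left node.
      Replacing \<open>g\<close> by its value at that node costs \<open>e\<close>, and moving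
      \<open>h''\<close> from the node to \<open>\<xi>\<close> costs at most \<open>M * e\<close>;
      both are multiplied by the cell length \<open>d\<close>.\<close>
    have piece: "integral {x (Suc i)..x (Suc (Suc i))} g
        \<le> w (x (Suc i)) * (h (x (i + 2)) - 2 * h (x (Suc i)) + h (x i)) / d + d * ((1 + M) * e)"
      if "i < n" for i
    proof -
      let ?y = "x (Suc i)"
      have y: "x i = ?y - d" "x (Suc (Suc i)) = ?y + d" "x (i + 2) = ?y + d"
        by (simp_all add: x_def algebra_simps)
      have in_ab: "?y \<in> {a..b}" "?y - d \<in> {a..b}" "?y + d \<in> {a..b}"
        using x_in[of i] x_in[of "Suc i"] x_in[of "i + 2"] that unfolding y by auto
      obtain \<xi> where \<xi>: "?y - d < \<xi>" "\<xi> < ?y + d"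
        "h (?y + d) - 2 * h ?y + h (?y - d) = d\<^sup>2 * h'' \<xi>"
      proof (rule second_difference_mean_value[OF \<open>d > 0\<close>])
        fix t assume t: "t \<in> {?y - d..?y + d}"
        have sub: "{?y - d..?y + d} \<subseteq> {a..b}"
          using in_ab by auto
        show "(h has_real_derivative h' t) (at t within {?y - d..?y + d})"
          using t sub by (intro DERIV_subset[OF C2_with_derivsD(1)[OF h(1)] sub]) auto
        show "(h' has_real_derivative h'' t) (at t within {?y - d..?y + d})"
          using t sub by (intro DERIV_subset[OF C2_with_derivsD(2)[OF h(1)] sub]) auto
      qed
      have "\<bar>h'' ?y - h'' \<xi>\<bar> < e"
        using \<xi> d in_ab by (intro \<delta>(3)) auto
      then have "w ?y * (h'' ?y - h'' \<xi>) \<le> w ?y * e"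
        using w(3)[OF in_ab(1)] by (intro mult_left_mono) auto
      also have "\<dots> \<le> M * e"
        using M(2)[OF in_ab(1)] \<open>e > 0\<close> by (intro mult_right_mono) auto
      finally have "w ?y * (h'' ?y - h'' \<xi>) \<le> M * e" .
      then have gy: "g ?y \<le> w ?y * h'' \<xi> + M * e"
        by (simp add: g_def algebra_simps)
      have "g t \<le> g ?y + e" if "t \<in> {?y..?y + d}" for t
        using \<delta>(2)[of ?y t] that d in_ab by auto
      then have "integral {?y..?y + d} g \<le> integral {?y..?y + d} (\<lambda>t. g ?y + e)"
        using in_ab by (intro integral_le int_g) auto
      also have "\<dots> = d * (g ?y + e)"
        using \<open>d > 0\<close> by simp
      also have "\<dots> \<le> d * (w ?y * h'' \<xi> + M * e + e)"
        using gy \<open>d > 0\<close> by (intro mult_left_mono) auto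
      also have "\<dots> = w ?y * (d\<^sup>2 * h'' \<xi>) / d + d * ((1 + M) * e)"
        using \<open>d > 0\<close> by (simp add: power2_eq_square algebra_simps)
      finally show ?thesis
        unfolding y using \<xi>(3) by simp
    qed
    \<comment> \<open>The left node of the first cell is \<open>a\<close>, where no centred
      difference fits inside \<open>{a..b}\<close>; a crude bound is enough for one cell.\<close>
    have first: "integral {x 0..x (Suc 0)} g \<le> d * G"
    proof -
      have "integral {x 0..x (Suc 0)} g \<le> integral {x 0..x (Suc 0)} (\<lambda>t. G)"
        using x_in[of 0] x_in[of 1] by (intro integral_le int_g) (auto intro!: order_trans[OF abs_ge_self G(2)])
      also have "\<dots> = d * G"
        using \<open>d > 0\<close> by (simp add: xS)
      finally show ?thesis .
    qed
    have "(\<Sum>i<n. h (x (Suc i)) * (w (x (i + 2)) - 2 * w (x (Suc i)) + w (x i))) \<le> 0"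
    proof (rule sum_nonpos)
      fix i assume "i \<in> {..<n}"
      then have i: "x i \<in> {a..b}" "x (Suc i) \<in> {a..b}" "x (i + 2) \<in> {a..b}"
        using x_in by auto
      have "d * w (x i) + d * w (x (i + 2)) \<le> 2 * d * w (x (Suc i))"
        using concave_on_three_points[OF w(1) i(1,3), of "x (Suc i)"] \<open>d > 0\<close> by (simp add: xS)
      then have "d * (w (x (i + 2)) - 2 * w (x (Suc i)) + w (x i)) \<le> 0"
        by (simp add: algebra_simps)
      then have "w (x (i + 2)) - 2 * w (x (Suc i)) + w (x i) \<le> 0"
        using \<open>d > 0\<close> by (simp add: mult_le_0_iff)
      with h(2)[OF i(2)] show "h (x (Suc i)) * (w (x (i + 2)) - 2 * w (x (Suc i)) + w (x i)) \<le> 0"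
        by (rule mult_nonneg_nonpos)
    qed
    \<comment> \<open>These are the surviving boundary terms. They enter the summation formula with
      a minus sign, so nonnegativity of \<open>w\<close> and \<open>h\<close> gives them the
      favourable sign.\<close>
    moreover have "w b * h (x n) \<ge> 0" "w a * h (x 1) \<ge> 0"
      using h(2) w(3) x_in[of n] x_in[of 1] \<open>a < b\<close> by auto
    ultimately have S: "(\<Sum>i<n. w (x (Suc i)) * (h (x (i + 2)) - 2 * h (x (Suc i)) + h (x i))) \<le> 0"
      using sum_second_difference_by_parts[of "\<lambda>i. w (x i)" "\<lambda>i. h (x i)" n] h(3,4) by (simp add: x0 xn)
    have "integral {a..b} g = (\<Sum>i<Suc n. integral {x i..x (Suc i)} g)"
      using integral_sum_consecutive[OF \<open>mono x\<close>, of g "Suc n"] int_g[of a b] \<open>a < b\<close> unfolding x0 xn by simp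
    also have "\<dots> = integral {x 0..x (Suc 0)} g + (\<Sum>i<n. integral {x (Suc i)..x (Suc (Suc i))} g)"
      by (rule sum.lessThan_Suc_shift)
    also have "\<dots> \<le> d * G + (\<Sum>i<n. w (x (Suc i)) * (h (x (i + 2)) - 2 * h (x (Suc i)) + h (x i)) / d
        + d * ((1 + M) * e))"
      using first piece by (intro add_mono sum_mono) auto
    also have "\<dots> = d * G + (\<Sum>i<n. w (x (Suc i)) * (h (x (i + 2)) - 2 * h (x (Suc i)) + h (x i))) / d
        + real n * d * ((1 + M) * e)"
      by (simp add: sum.distrib sum_divide_distrib)
    also have "\<dots> \<le> e + 0 + (b - a) * ((1 + M) * e)"
    proof (intro add_mono mult_right_mono)
      show "real n * d \<le> b - a"
        using \<open>a < b\<close> by (simp add: d_def field_simps)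
    qed (use d S \<open>d > 0\<close> M(1) \<open>e > 0\<close> in \<open>auto simp: divide_le_0_iff\<close>)
    finally show ?thesis
      by (simp add: algebra_simps)
  qed
  then have *: "integral {a..b} g \<le> e * (1 + (1 + M) * (b - a))" if "e > 0" for e
    using that by blast
  \<comment> \<open>The error is \<open>e * K\<close> with \<open>K\<close> independent of
    \<open>e\<close>; rescaling \<open>e\<close> by \<open>K\<close> makes it arbitrarily
    small.\<close>
  define K where "K = 1 + (1 + M) * (b - a)"
  have "K > 0"
    using M(1) \<open>a < b\<close> by (simp add: K_def add_pos_nonneg)
  have "integral {a..b} g \<le> 0 + e" if "e > 0" for e
    using *[of "e / K"] that \<open>K > 0\<close> unfolding K_def[symmetric] by simp
  then show ?thesis
    unfolding g_def by (rule field_le_epsilon)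
qed

section \<open>A bump function and the rigidity of the sign result\<close>

text \<open>Only the origin is delicate. There the difference quotient is
  \<open>max 0 z ^ Suc n\<close>, which is continuous, so Caratheodory's criterion applies.\<close>

lemma DERIV_max_0_power:
  "((\<lambda>x::real. max 0 x ^ Suc (Suc n)) has_real_derivative real (n + 2) * max 0 x ^ Suc n) (at x)"
proof -
  consider "x > 0" | "x < 0" | "x = 0" by linarith
  then show ?thesis
  proof cases
    case 1
    have "((\<lambda>x. x ^ Suc (Suc n)) has_real_derivative real (n + 2) * max 0 x ^ Suc n) (at x)"
      using DERIV_pow[of "Suc (Suc n)" x] 1 by simp
    then show ?thesis
      by (rule has_field_derivative_transform_within_open[of _ _ _ "{0<..}"]) (use 1 in auto)
  next
    case 2
    have "((\<lambda>x. 0) has_real_derivative real (n + 2) * max 0 x ^ Suc n) (at x)"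
      using 2 by (simp add: max_def)
    then show ?thesis
      by (rule has_field_derivative_transform_within_open[of _ _ _ "{..<0}"]) (use 2 in auto)
  next
    case 3
    have "max 0 z ^ Suc (Suc n) - max 0 x ^ Suc (Suc n) = max 0 z ^ Suc n * (z - x)" for z
      using 3 by (simp add: max_def)
    moreover have "isCont (\<lambda>z. max 0 z ^ Suc n) x"
      by (intro continuous_intros)
    ultimately show ?thesis
      unfolding CARAT_DERIV using 3 by (intro exI[of _ "\<lambda>z. max 0 z ^ Suc n"]) auto
  qed
qed

text \<open>The cube is what gives a C^2 function: two differentiations leave one continuous factor
  \<open>max 0 (...)\<close>, so nothing breaks at the edges of the support.\<close>

definition bump :: "real \<Rightarrow> real \<Rightarrow> real \<Rightarrow> real" where
  "bump c r x = max 0 (r\<^sup>2 - (x - c)\<^sup>2) ^ 3"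

definition bump' :: "real \<Rightarrow> real \<Rightarrow> real \<Rightarrow> real" where
  "bump' c r x = - 6 * (x - c) * max 0 (r\<^sup>2 - (x - c)\<^sup>2) ^ 2"

definition bump'' :: "real \<Rightarrow> real \<Rightarrow> real \<Rightarrow> real" where
  "bump'' c r x = - 6 * max 0 (r\<^sup>2 - (x - c)\<^sup>2) * (r\<^sup>2 - 5 * (x - c)\<^sup>2)"

lemma DERIV_bump: "(bump c r has_real_derivative bump' c r x) (at x)"
proof -
  have "((\<lambda>x. r\<^sup>2 - (x - c)\<^sup>2) has_real_derivative - 2 * (x - c)) (at x)"
    by (auto intro!: derivative_eq_intros)
  from DERIV_chain2[OF DERIV_max_0_power[of 1] this] show ?thesis
    unfolding bump_def[abs_def] bump'_def by (simp add: eval_nat_numeral algebra_simps)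
qed

lemma DERIV_bump': "(bump' c r has_real_derivative bump'' c r x) (at x)"
proof -
  have "((\<lambda>x. r\<^sup>2 - (x - c)\<^sup>2) has_real_derivative - 2 * (x - c)) (at x)"
    by (auto intro!: derivative_eq_intros)
  from DERIV_chain2[OF DERIV_max_0_power[of 0] this]
  have 1: "((\<lambda>x. max 0 (r\<^sup>2 - (x - c)\<^sup>2) ^ 2) has_real_derivative
      - 4 * (x - c) * max 0 (r\<^sup>2 - (x - c)\<^sup>2)) (at x)"
    by (simp add: eval_nat_numeral algebra_simps)
  have "((\<lambda>x. - 6 * (x - c)) has_real_derivative - 6) (at x)"
    by (auto intro!: derivative_eq_intros)
  from DERIV_mult[OF this 1]
  have "(bump' c r has_real_derivative
      - 6 * max 0 (r\<^sup>2 - (x - c)\<^sup>2) ^ 2 + (- 4 * (x - c) * max 0 (r\<^sup>2 - (x - c)\<^sup>2)) * (- 6 * (x - c))) (at x)"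
    unfolding bump'_def[abs_def] by simp
  \<comment> \<open>Factoring out the maximum leaves
    \<open>max 0 (...) - 4 * (x - c)\<^sup>2\<close>. This is the last factor of
    \<open>bump''\<close> where the maximum is positive, and elsewhere both sides vanish.\<close>
  also have "- 6 * max 0 (r\<^sup>2 - (x - c)\<^sup>2) ^ 2 + (- 4 * (x - c) * max 0 (r\<^sup>2 - (x - c)\<^sup>2)) * (- 6 * (x - c))
      = bump'' c r x"
    by (simp add: bump''_def max_def power2_eq_square algebra_simps)
  finally show ?thesis .
qed

lemma continuous_on_bump'': "continuous_on S (bump'' c r)"
  unfolding bump''_def[abs_def] by (intro continuous_intros)

lemma bump_outside:
  assumes "r \<ge> 0" "\<bar>x - c\<bar> \<ge> r"
  shows "bump c r x = 0" "bump' c r x = 0" "bump'' c r x = 0"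
proof -
  have "r\<^sup>2 \<le> (x - c)\<^sup>2"
    using assms by (simp add: abs_le_square_iff[symmetric])
  then show "bump c r x = 0" "bump' c r x = 0" "bump'' c r x = 0"
    by (simp_all add: bump_def bump'_def bump''_def)
qed

text \<open>A concave function lies above a chord between its two nodes and below the prolonged
  chord outside them. With the nodes at the sign changes of \<open>bump''\<close>, this fixes the
  sign of \<open>(l x - w x) * bump'' c r x\<close> throughout.\<close>

lemma affine_of_integral_bump''_nonneg:
  fixes w :: "real \<Rightarrow> real"
  assumes "r > 0" and w: "concave_on {c - r..c + r} w" "continuous_on {c - r..c + r} w"
    and int: "0 \<le> integral {c - r..c + r} (\<lambda>x. w x * bump'' c r x)"
  shows "affine_fun_on {c - r..c + r} w"
proof -
  define J where "J = {c - r..c + r}"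
  \<comment> \<open>\<open>bump'' c r\<close> changes sign exactly at \<open>c - s\<close> and \<open>c + s\<close>; \<open>l\<close> is the chord of \<open>w\<close> through these points\<close>
  define s where "s = r / sqrt 5"
  have s: "s > 0" "s < r" "5 * s\<^sup>2 = r\<^sup>2"
    using \<open>r > 0\<close> real_sqrt_less_mono[of 1 5] by (auto simp: s_def power_divide field_simps)
  define m where "m = (w (c + s) - w (c - s)) / (2 * s)"
  define l where "l x = w (c - s) + m * (x - (c - s))" for x
  have ms: "2 * s * m = w (c + s) - w (c - s)"
    using s by (simp add: m_def)
  \<comment> \<open>Multiplied by \<open>2 * s\<close>, the chord takes the division-free form that
    \<open>concave_on_three_points\<close> delivers.\<close>
  have l_sl: "2 * s * l x = (c + s - x) * w (c - s) + (x - (c - s)) * w (c + s)" for x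
  proof -
    have "2 * s * l x = 2 * s * w (c - s) + (2 * s * m) * (x - (c - s))"
      by (simp add: l_def algebra_simps)
    then show ?thesis
      unfolding ms by (simp add: algebra_simps)
  qed
  have inside: "c - s \<in> J" "c + s \<in> J"
    using s by (auto simp: J_def)
  note three = concave_on_three_points[OF w(1)[folded J_def]]
  have l_le: "l x \<le> w x" if "\<bar>x - c\<bar> \<le> s" for x
  proof -
    have "2 * s * l x \<le> 2 * s * w x"
      using three[OF inside, of x] that unfolding l_sl by (simp add: abs_le_iff)
    then show ?thesis using s by simp
  qed
  have l_ge: "w x \<le> l x" if "x \<in> J" "s \<le> \<bar>x - c\<bar>" for x
  proof -
    have "2 * s * w x \<le> 2 * s * l x"
    proof (cases "x \<ge> c")
      case True
      then show ?thesis
        using three[OF inside(1) \<open>x \<in> J\<close>, of "c + s"] that s unfolding l_sl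
        by (simp add: algebra_simps)
    next
      case False
      then show ?thesis
        using three[OF \<open>x \<in> J\<close> inside(2), of "c - s"] that s unfolding l_sl
        by (simp add: algebra_simps)
    qed
    then show ?thesis using s by simp
  qed
  define k where "k x = (l x - w x) * bump'' c r x" for x
  have contl: "continuous_on J l"
    unfolding l_def by (intro continuous_intros)
  have k_nonneg: "k x \<ge> 0" if "x \<in> J" for x
  proof (cases "\<bar>x - c\<bar> \<le> s")
    case True
    then have "(x - c)\<^sup>2 \<le> s\<^sup>2"
      using s by (simp add: abs_le_square_iff[symmetric])
    then have "bump'' c r x \<le> 0"
      using s(3) unfolding bump''_def by (intro mult_nonpos_nonneg) auto
    with l_le[OF True] show ?thesis
      unfolding k_def by (intro mult_nonpos_nonpos) auto
  next
    case False
    then have "s\<^sup>2 \<le> (x - c)\<^sup>2"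
      using s by (simp add: abs_le_square_iff[symmetric])
    then have "bump'' c r x \<ge> 0"
      using s(3) unfolding bump''_def by (intro mult_nonpos_nonpos) auto
    with l_ge[OF that] False show ?thesis
      unfolding k_def by (intro mult_nonneg_nonneg) auto
  qed
  \<comment> \<open>Two integrations by parts, with no remaining integral because \<open>l\<close>
    is affine. The boundary terms are zero since \<open>bump\<close> and \<open>bump'\<close> vanish
    at \<open>c - r\<close> and \<open>c + r\<close>.\<close>
  have "((\<lambda>x. l x * bump'' c r x) has_integral
      (l (c + r) * bump' c r (c + r) - m * bump c r (c + r))
      - (l (c - r) * bump' c r (c - r) - m * bump c r (c - r))) J"
    unfolding J_def
  proof (rule fundamental_theorem_of_calculus)
    fix x assume "x \<in> {c - r..c + r}"
    have "(l has_real_derivative m) (at x)"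
      unfolding l_def by (auto intro!: derivative_eq_intros)
    from DERIV_diff[OF DERIV_mult[OF this DERIV_bump'[of c r x]] DERIV_cmult[OF DERIV_bump[of c r x], of m]]
    have "((\<lambda>x. l x * bump' c r x - m * bump c r x) has_real_derivative l x * bump'' c r x)
        (at x)"
      by (simp add: algebra_simps)
    then show "((\<lambda>x. l x * bump' c r x - m * bump c r x) has_vector_derivative l x * bump'' c r x)
        (at x within {c - r..c + r})"
      by (simp add: has_real_derivative_iff_has_vector_derivative has_vector_derivative_at_within)
  qed (use \<open>r > 0\<close> in auto)
  then have int_l: "((\<lambda>x. l x * bump'' c r x) has_integral 0) J"
    using \<open>r > 0\<close> by (simp add: bump_outside)
  have "(\<lambda>x. w x * bump'' c r x) integrable_on J"
    unfolding J_def using w(2) by (intro integrable_continuous_real continuous_intros continuous_on_bump'')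
  from has_integral_diff[OF int_l integrable_integral[OF this]]
  have "integral J k = - integral J (\<lambda>x. w x * bump'' c r x)"
    by (intro integral_unique) (simp add: k_def[abs_def] algebra_simps)
  moreover have contk: "continuous_on J k"
    unfolding k_def using contl w(2)[folded J_def] by (intro continuous_intros continuous_on_bump'')
  ultimately have "integral J k = 0"
    using int k_nonneg integral_nonneg[of k J] integrable_continuous_real[of "c - r" "c + r" k]
    unfolding J_def by auto
  then have k0: "\<forall>x\<in>J. k x = 0"
    using integral_eq_0_iff[of "c - r" "c + r" k] contk k_nonneg \<open>r > 0\<close> unfolding J_def by auto
  \<comment> \<open>At the two nodes the chord meets \<open>w\<close> by construction; at the other
    interior points \<open>bump''\<close> is nonzero and can be cancelled from
    \<open>k x = 0\<close>. The endpoints follow by continuity.\<close>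
  have "w x - l x = 0" if x: "x \<in> {c - r<..<c + r}" for x
  proof (cases "\<bar>x - c\<bar> = s")
    case True
    then have "x = c - s \<or> x = c + s" by auto
    then show ?thesis
      using ms by (auto simp: l_def algebra_simps)
  next
    case False
    have "\<bar>x - c\<bar> < r"
      using x by auto
    then have "(x - c)\<^sup>2 < r\<^sup>2"
      using \<open>r > 0\<close> abs_le_square_iff[of r "x - c"] by linarith
    moreover have "(x - c)\<^sup>2 \<noteq> s\<^sup>2"
      using False s by (simp add: power2_eq_iff abs_if split: if_splits)
    ultimately have "bump'' c r x \<noteq> 0"
      using s(3) by (simp add: bump''_def)
    moreover have "k x = 0"
      using k0 x by (auto simp: J_def)
    ultimately show ?thesis
      by (simp add: k_def)
  qed
  moreover have "closure {c - r<..<c + r} = J"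
    using \<open>r > 0\<close> by (simp add: J_def)
  moreover have "continuous_on J (\<lambda>x. w x - l x)"
    using contl w(2)[folded J_def] by (intro continuous_intros)
  ultimately have "w x - l x = 0" if "x \<in> J" for x
    using continuous_constant_on_closure[of "{c - r<..<c + r}" "\<lambda>x. w x - l x" 0 x] that by simp
  then have "\<forall>x\<in>J. w x = m * x + (w (c - s) - m * (c - s))"
    by (auto simp: l_def algebra_simps)
  then show ?thesis
    unfolding affine_fun_on_def J_def by blast
qed

text \<open>A perturbation argument: \<open>h - k * bump\<close> is still nonnegative and zero at
  the endpoints, so the sign result applies to it. As the contribution of \<open>h\<close> is zero,
  the integral of \<open>w * bump''\<close> cannot be negative.\<close>

lemma affine_of_integral_eq_0:
  fixes w h h' h'' :: "real \<Rightarrow> real"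
  assumes "a < b"
    and w: "concave_on {a..b} w" "continuous_on {a..b} w" "\<And>x. x \<in> {a..b} \<Longrightarrow> 0 \<le> w x"
    and h: "C2_with_derivs a b h h' h''" "\<And>x. x \<in> {a..b} \<Longrightarrow> 0 \<le> h x" "h a = 0" "h b = 0"
    and int: "integral {a..b} (\<lambda>x. w x * h'' x) = 0"
    and J: "0 < r" "a \<le> c - r" "c + r \<le> b"
    and "0 < k" "\<And>x. x \<in> {c - r..c + r} \<Longrightarrow> k * bump c r x \<le> h x"
  shows "affine_fun_on {c - r..c + r} w"
proof -
  have sub: "{c - r..c + r} \<subseteq> {a..b}"
    using J by auto
  have le: "k * bump c r x \<le> h x" if "x \<in> {a..b}" for x
  proof (cases "\<bar>x - c\<bar> \<ge> r")
    case True
    then show ?thesis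
      using J(1) h(2)[OF that] by (simp add: bump_outside)
  next
    case False
    then show ?thesis
      by (intro assms) auto
  qed
  have C2: "C2_with_derivs a b (\<lambda>x. h x - k * bump c r x) (\<lambda>x. h' x - k * bump' c r x)
      (\<lambda>x. h'' x - k * bump'' c r x)"
    using h(1) unfolding C2_with_derivs_def
    by (auto intro!: DERIV_diff DERIV_cmult continuous_intros continuous_on_bump''
        DERIV_bump[THEN DERIV_subset] DERIV_bump'[THEN DERIV_subset])
  have "bump c r a = 0" "bump c r b = 0"
    using J by (auto intro!: bump_outside)
  then have "integral {a..b} (\<lambda>x. w x * (h'' x - k * bump'' c r x)) \<le> 0"
    using le h(3,4)
    by (intro integral_concave_times_second_derivative_nonpos[OF \<open>a < b\<close> w C2]) auto
  also have "(\<lambda>x. w x * (h'' x - k * bump'' c r x)) = (\<lambda>x. w x * h'' x - k * (w x * bump'' c r x))"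
    by (simp add: algebra_simps)
  also have "integral {a..b} \<dots> = integral {a..b} (\<lambda>x. w x * h'' x) - integral {a..b} (\<lambda>x. k * (w x * bump'' c r x))"
    using w(2) C2_with_derivsD(5)[OF h(1)]
    by (intro integral_diff integrable_continuous_real continuous_intros continuous_on_bump'')
  finally have "0 \<le> integral {a..b} (\<lambda>x. w x * bump'' c r x)"
    using int \<open>0 < k\<close> by (simp add: zero_le_mult_iff)
  \<comment> \<open>The integrand vanishes off the support of the bump, which localises the integral
    to that subinterval.\<close>
  also have "\<dots> = integral {a..b} (\<lambda>x. if x \<in> {c - r..c + r} then w x * bump'' c r x else 0)"
  proof (rule integral_cong)
    fix x
    have "\<bar>x - c\<bar> \<ge> r" if "x \<notin> {c - r..c + r}"
      using that by auto
    then show "w x * bump'' c r x = (if x \<in> {c - r..c + r} then w x * bump'' c r x else 0)"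
      using J(1) by (simp add: bump_outside)
  qed
  also have "\<dots> = integral {c - r..c + r} (\<lambda>x. w x * bump'' c r x)"
    using sub by (simp only: Henstock_Kurzweil_Integration.integral_restrict_Int Int_absorb2)
  finally show ?thesis
    using convex_on_subset[OF w(1)[unfolded concave_on_def] sub] continuous_on_subset[OF w(2) sub]
    unfolding concave_on_def[symmetric] by (intro affine_of_integral_bump''_nonneg J(1)) auto
qed

section \<open>Comparison of the bump with a squared cosine\<close>

text \<open>Concavity puts the sine above its chord from \<open>0\<close> to \<open>pi / 2\<close>;
  passing to the complementary angle gives the cosine.\<close>

lemma Jordan_inequality_cos:
  assumes "\<bar>u\<bar> \<le> 1"
  shows "1 - \<bar>u\<bar> \<le> cos (u * pi / 2)"
proof -
  have "concave_on {0..pi} sin"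
    by (rule f''_le0_imp_concave[where f' = cos and f'' = "\<lambda>x. - sin x"])
      (auto intro!: derivative_eq_intros sin_ge_zero)
  from concave_on_three_points[OF this, of 0 "pi / 2" "(1 - \<bar>u\<bar>) * pi / 2"] assms
  have "(1 - \<bar>u\<bar>) * (pi / 2) \<le> (pi / 2) * sin ((1 - \<bar>u\<bar>) * pi / 2)"
    by simp
  then have "1 - \<bar>u\<bar> \<le> sin ((1 - \<bar>u\<bar>) * pi / 2)"
    by simp
  also have "\<dots> = cos (\<bar>u * pi / 2\<bar>)"
    by (simp add: cos_sin_eq algebra_simps abs_mult diff_divide_distrib)
  also have "\<dots> = cos (u * pi / 2)"
    by (rule cos_abs_real)
  finally show ?thesis .
qed

text \<open>In the coordinate \<open>u = (x - c) / r\<close> the bump is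
  \<open>r ^ 6 * (1 - u\<^sup>2) ^ 3\<close>. One factor is dropped, and each remaining factor
  \<open>(1 + \<bar>u\<bar>) * (1 - \<bar>u\<bar>)\<close> is at most twice the cosine, whence the
  constant 4.\<close>

lemma bump_le_cos_squared:
  assumes "0 < r" "\<bar>x - c\<bar> \<le> r"
  shows "bump c r x \<le> 4 * r ^ 6 * (cos ((x - c) / r * pi / 2))\<^sup>2"
proof -
  define u where "u = (x - c) / r"
  have u: "\<bar>u\<bar> \<le> 1"
    using assms by (simp add: u_def)
  have u2: "u\<^sup>2 \<le> 1"
    using u by (simp add: abs_square_le_1)
  have x: "x - c = r * u"
    using assms by (simp add: u_def)
  have "r\<^sup>2 - (x - c)\<^sup>2 = r\<^sup>2 * (1 - u\<^sup>2)"
    by (simp add: x power_mult_distrib algebra_simps)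
  then have b: "bump c r x = r ^ 6 * (1 - u\<^sup>2) ^ 3"
    using u2 by (simp add: bump_def power_mult_distrib flip: power_mult)
  have "(1 - u\<^sup>2) ^ 3 \<le> (1 - u\<^sup>2)\<^sup>2"
    using u2 by (intro power_decreasing) auto
  also have "(1 - u\<^sup>2)\<^sup>2 = ((1 + \<bar>u\<bar>) * (1 - \<bar>u\<bar>))\<^sup>2"
    by (simp add: algebra_simps flip: power2_eq_square)
  also have "\<dots> \<le> (2 * cos (u * pi / 2))\<^sup>2"
    using u Jordan_inequality_cos[OF u] by (intro power_mono mult_mono) auto
  finally have "r ^ 6 * (1 - u\<^sup>2) ^ 3 \<le> r ^ 6 * (2 * cos (u * pi / 2))\<^sup>2"
    using \<open>0 < r\<close> by (intro mult_left_mono) auto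
  also have "\<dots> = 4 * r ^ 6 * (cos (u * pi / 2))\<^sup>2"
    by (simp add: power_mult_distrib)
  finally show ?thesis
    unfolding b u_def .
qed

section \<open>The square of a C^2 function and the weighted Cauchy-Schwarz inequality\<close>

lemma C2_with_derivs_square:
  assumes "C2_with_derivs a b f f' f''"
  shows "C2_with_derivs a b (\<lambda>x. (f x)\<^sup>2) (\<lambda>x. 2 * (f x * f' x)) (\<lambda>x. 2 * ((f' x)\<^sup>2 + f x * f'' x))"
  unfolding C2_with_derivs_def
proof (intro conjI ballI)
  note D = C2_with_derivsD[OF assms]
  fix x assume x: "x \<in> {a..b}"
  show "((\<lambda>x. (f x)\<^sup>2) has_real_derivative 2 * (f x * f' x)) (at x within {a..b})"
    using DERIV_power[OF D(1)[OF x], of 2] by (simp add: mult_ac)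
  have "((\<lambda>x. f x * f' x) has_real_derivative f' x * f' x + f'' x * f x) (at x within {a..b})"
    by (intro DERIV_mult D x)
  from DERIV_cmult[OF this, of 2]
  show "((\<lambda>x. 2 * (f x * f' x)) has_real_derivative 2 * ((f' x)\<^sup>2 + f x * f'' x)) (at x within {a..b})"
    by (simp add: power2_eq_square mult.commute)
next
  note D = C2_with_derivsD[OF assms]
  show "continuous_on {a..b} (\<lambda>x. 2 * ((f' x)\<^sup>2 + f x * f'' x))"
    by (intro continuous_intros D)
qed

text \<open>The quadratic in \<open>t\<close> behind Cauchy-Schwarz; the equality case evaluates it
  again at its minimiser.\<close>

lemma integral_weighted_square_add:
  fixes w f g :: "real \<Rightarrow> real"
  assumes "continuous_on {a..b} w" "continuous_on {a..b} f" "continuous_on {a..b} g"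
  shows "integral {a..b} (\<lambda>x. w x * (g x + t * f x)\<^sup>2)
    = integral {a..b} (\<lambda>x. w x * (g x)\<^sup>2) + 2 * t * integral {a..b} (\<lambda>x. w x * (f x * g x))
      + t\<^sup>2 * integral {a..b} (\<lambda>x. w x * (f x)\<^sup>2)"
proof -
  have "(\<lambda>x. w x * (g x + t * f x)\<^sup>2)
      = (\<lambda>x. w x * (g x)\<^sup>2 + 2 * t * (w x * (f x * g x)) + t\<^sup>2 * (w x * (f x)\<^sup>2))"
    by (simp add: power2_eq_square algebra_simps)
  then show ?thesis
    using assms
    by (simp add: integral_add integrable_continuous_real continuous_intros)
qed

lemma weighted_Cauchy_Schwarz_integral:
  fixes w f g :: "real \<Rightarrow> real"
  assumes cont: "continuous_on {a..b} w" "continuous_on {a..b} f" "continuous_on {a..b} g"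
    and w: "\<And>x. x \<in> {a..b} \<Longrightarrow> 0 \<le> w x"
  shows "(integral {a..b} (\<lambda>x. w x * (f x * g x)))\<^sup>2
    \<le> integral {a..b} (\<lambda>x. w x * (f x)\<^sup>2) * integral {a..b} (\<lambda>x. w x * (g x)\<^sup>2)"
proof -
  define B where "B = integral {a..b} (\<lambda>x. w x * (f x)\<^sup>2)"
  define C where "C = integral {a..b} (\<lambda>x. w x * (g x)\<^sup>2)"
  define P where "P = integral {a..b} (\<lambda>x. w x * (f x * g x))"
  have q: "0 \<le> C + 2 * t * P + t\<^sup>2 * B" for t
    unfolding B_def C_def P_def integral_weighted_square_add[OF cont, symmetric]
    using cont w by (intro integral_nonneg integrable_continuous_real continuous_intros) auto
  have "0 \<le> B"
    unfolding B_def using cont w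
    by (intro integral_nonneg integrable_continuous_real continuous_intros) auto
  show ?thesis
  proof (cases "B = 0")
    case True
    have "P = 0"
    proof (rule ccontr)
      assume "P \<noteq> 0"
      \<comment> \<open>With \<open>B = 0\<close> the quadratic degenerates to a linear function of
        \<open>t\<close>; this \<open>t\<close> makes it equal to -1.\<close>
      then have "C + 2 * (- (C + 1) / (2 * P)) * P = - 1"
        by (simp add: field_simps)
      with q[of "- (C + 1) / (2 * P)"] True show False
        by simp
    qed
    with True show ?thesis
      unfolding B_def[symmetric] P_def[symmetric] by simp
  next
    case False
    with \<open>0 \<le> B\<close> have "B > 0" by simp
    \<comment> \<open>The minimiser of the quadratic is \<open>t = - P / B\<close>.\<close>
    have "C + 2 * (- P / B) * P + (- P / B)\<^sup>2 * B = C - P\<^sup>2 / B"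
      using False by (simp add: field_simps power2_eq_square)
    with q[of "- P / B"] have "P\<^sup>2 / B \<le> C"
      by simp
    then have "P\<^sup>2 \<le> B * C"
      using \<open>B > 0\<close> by (simp add: field_simps)
    then show ?thesis
      unfolding B_def C_def P_def .
  qed
qed

section \<open>Uniqueness of derivatives and the harmonic oscillator\<close>

lemma at_within_Icc_neq_bot:
  fixes a b :: real
  assumes "a < b" "x \<in> {a..b}"
  shows "at x within {a..b} \<noteq> bot"
  using assms by (simp add: trivial_limit_within islimpt_Icc)

text \<open>Allows a given \<open>f''\<close> to be replaced by an explicit formula once
  \<open>f\<close> is known on \<open>{a..b}\<close>, endpoints included.\<close>

lemma C2_with_derivs_unique:
  assumes "a < b" "C2_with_derivs a b f f' f''" "C2_with_derivs a b g g' g''"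
    and "\<And>x. x \<in> {a..b} \<Longrightarrow> f x = g x" "x \<in> {a..b}"
  shows "f' x = g' x" "f'' x = g'' x"
proof -
  have unique: "u' x = v' x"
    if "\<And>x. x \<in> {a..b} \<Longrightarrow> u x = v x" "x \<in> {a..b}"
      "(u has_real_derivative u' x) (at x within {a..b})" "(v has_real_derivative v' x) (at x within {a..b})"
    for u v u' v' :: "real \<Rightarrow> real" and x
  proof (rule has_field_derivative_unique)
    show "(v has_real_derivative u' x) (at x within {a..b})"
      using that by (intro has_field_derivative_transform_within[OF that(3), of 1]) auto
  qed (use that at_within_Icc_neq_bot[OF assms(1)] in auto)
  have 1: "f' x = g' x" if "x \<in> {a..b}" for x
    using unique[of f g x f' g'] assms that C2_with_derivsD(1)[OF assms(2) that] C2_with_derivsD(1)[OF assms(3) that]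
    by simp
  then show "f' x = g' x"
    using assms(5) .
  show "f'' x = g'' x"
    using unique[of f' g' x f'' g''] 1 assms(5) C2_with_derivsD(2)[OF assms(2,5)] C2_with_derivsD(2)[OF assms(3,5)]
    by simp
qed

lemma C2_with_derivs_sin:
  "C2_with_derivs a b (\<lambda>x. c * sin (\<kappa> * (x - a))) (\<lambda>x. c * \<kappa> * cos (\<kappa> * (x - a)))
    (\<lambda>x. - (\<kappa>\<^sup>2 * (c * sin (\<kappa> * (x - a)))))"
  unfolding C2_with_derivs_def
  by (auto intro!: derivative_eq_intros continuous_intros simp: power2_eq_square)

text \<open>Uniqueness for the initial value problem: the sine on the right has the same value and
  slope at \<open>a\<close> as \<open>f\<close>.\<close>

lemma oscillator_solution:
  assumes "C2_with_derivs a b f f' f''" "f a = 0" "\<kappa> \<noteq> 0"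
    and ode: "\<And>x. x \<in> {a..b} \<Longrightarrow> f'' x = - (\<kappa>\<^sup>2 * f x)"
    and "x \<in> {a..b}"
  shows "f x = f' a / \<kappa> * sin (\<kappa> * (x - a))"
proof -
  define g where "g x = f x - f' a / \<kappa> * sin (\<kappa> * (x - a))" for x
  define g' where "g' x = f' x - f' a * cos (\<kappa> * (x - a))" for x
  have g: "(g has_real_derivative g' x) (at x within {a..b})" if "x \<in> {a..b}" for x
  proof -
    have "((\<lambda>x. f' a / \<kappa> * sin (\<kappa> * (x - a))) has_real_derivative f' a * cos (\<kappa> * (x - a))) (at x within {a..b})"
      using \<open>\<kappa> \<noteq> 0\<close> by (auto intro!: derivative_eq_intros)
    from DERIV_diff[OF C2_with_derivsD(1)[OF assms(1) that] this] show ?thesis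
      unfolding g_def[abs_def] g'_def .
  qed
  have g': "(g' has_real_derivative - (\<kappa>\<^sup>2 * g x)) (at x within {a..b})" if "x \<in> {a..b}" for x
  proof -
    have "((\<lambda>x. f' a * cos (\<kappa> * (x - a))) has_real_derivative - (f' a * \<kappa> * sin (\<kappa> * (x - a)))) (at x within {a..b})"
      by (auto intro!: derivative_eq_intros)
    from DERIV_diff[OF C2_with_derivsD(2)[OF assms(1) that] this]
    have "(g' has_real_derivative f'' x + f' a * \<kappa> * sin (\<kappa> * (x - a))) (at x within {a..b})"
      unfolding g'_def[abs_def] by simp
    also have "f'' x + f' a * \<kappa> * sin (\<kappa> * (x - a)) = - (\<kappa>\<^sup>2 * g x)"
      using \<open>\<kappa> \<noteq> 0\<close> ode[OF that] by (simp add: g_def power2_eq_square field_simps)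
    finally show ?thesis .
  qed
  \<comment> \<open>the energy of the difference is conserved and vanishes at \<open>a\<close>\<close>
  have "((\<lambda>x. (g' x)\<^sup>2 + \<kappa>\<^sup>2 * (g x)\<^sup>2) has_real_derivative 0) (at x within {a..b})"
    if "x \<in> {a..b}" for x
    using DERIV_add[OF DERIV_power[OF g'[OF that], of 2] DERIV_cmult[OF DERIV_power[OF g[OF that], of 2], of "\<kappa>\<^sup>2"]]
    by (simp add: algebra_simps)
  then obtain c where c: "\<And>x. x \<in> {a..b} \<Longrightarrow> (g' x)\<^sup>2 + \<kappa>\<^sup>2 * (g x)\<^sup>2 = c"
    using has_field_derivative_zero_constant[of "{a..b}" "\<lambda>x. (g' x)\<^sup>2 + \<kappa>\<^sup>2 * (g x)\<^sup>2"] by auto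
  have "c = 0"
    using c[of a] assms(2,5) by (simp add: g_def g'_def)
  then have "\<kappa>\<^sup>2 * (g x)\<^sup>2 = 0"
    using c[OF assms(5)] add_nonneg_eq_0_iff[of "(g' x)\<^sup>2" "\<kappa>\<^sup>2 * (g x)\<^sup>2"] by simp
  then show ?thesis
    using \<open>\<kappa> \<noteq> 0\<close> by (simp add: g_def)
qed

section \<open>The two directions of the equality case\<close>

text \<open>Integration by parts twice, with primitive \<open>w * h' - \<alpha> * h\<close>. It is
  meant for \<open>h\<close> the square of \<open>f\<close> between zeros of \<open>f\<close>, where
  \<open>h'\<close> vanishes together with \<open>h\<close>.\<close>

lemma integral_affine_times_second_derivative_eq_0:
  assumes "p \<le> q" "affine_fun_on {p..q} w" "C2_with_derivs p q h h' h''"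
    and "h p = 0" "h q = 0" "h' p = 0" "h' q = 0"
  shows "integral {p..q} (\<lambda>x. w x * h'' x) = 0"
proof -
  obtain \<alpha> \<beta> where w: "\<And>x. x \<in> {p..q} \<Longrightarrow> w x = \<alpha> * x + \<beta>"
    using assms(2) by (auto simp: affine_fun_on_def)
  have "((\<lambda>x. (\<alpha> * x + \<beta>) * h'' x) has_integral
      ((\<alpha> * q + \<beta>) * h' q - \<alpha> * h q) - ((\<alpha> * p + \<beta>) * h' p - \<alpha> * h p)) {p..q}"
  proof (rule fundamental_theorem_of_calculus)
    fix x assume x: "x \<in> {p..q}"
    have "((\<lambda>x. \<alpha> * x + \<beta>) has_real_derivative \<alpha>) (at x within {p..q})"
      by (auto intro!: derivative_eq_intros)
    from DERIV_diff[OF DERIV_mult[OF this C2_with_derivsD(2)[OF assms(3) x]]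
        DERIV_cmult[OF C2_with_derivsD(1)[OF assms(3) x], of \<alpha>]]
    show "((\<lambda>x. (\<alpha> * x + \<beta>) * h' x - \<alpha> * h x) has_vector_derivative (\<alpha> * x + \<beta>) * h'' x)
        (at x within {p..q})"
      by (simp add: has_real_derivative_iff_has_vector_derivative[symmetric] mult.commute)
  qed fact
  then have "integral {p..q} (\<lambda>x. (\<alpha> * x + \<beta>) * h'' x) = 0"
    using assms by (simp add: integral_unique)
  also have "integral {p..q} (\<lambda>x. (\<alpha> * x + \<beta>) * h'' x) = integral {p..q} (\<lambda>x. w x * h'' x)"
    using w by (intro integral_cong) simp
  finally show ?thesis .
qed

lemma C2_with_derivs_subset:
  assumes "C2_with_derivs a b f f' f''" "{p..q} \<subseteq> {a..b}"
  shows "C2_with_derivs p q f f' f''"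
  using assms unfolding C2_with_derivs_def
  by (meson DERIV_subset continuous_on_subset subset_iff)

text \<open>The point \<open>x\<close> lies on the chord side between \<open>y\<close> and an
  endpoint of the interval; the chord there is positive because \<open>w y > 0\<close> and the
  endpoint value is nonnegative.\<close>

lemma concave_on_pos_interior:
  fixes w :: "real \<Rightarrow> real"
  assumes "concave_on {a..b} w" "\<And>x. x \<in> {a..b} \<Longrightarrow> 0 \<le> w x"
    and "y \<in> {a..b}" "w y \<noteq> 0" "a < x" "x < b"
  shows "0 < w x"
proof (cases "x \<le> y")
  case True
  have "0 < (x - a) * w y"
    using assms(2)[of y] assms(3-) by simp
  also have "\<dots> \<le> (y - x) * w a + (x - a) * w y"
    using assms(2)[of a] assms(3,5,6) True by simp
  also have "\<dots> \<le> (y - a) * w x"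
    using assms True by (intro concave_on_three_points[OF assms(1)]) auto
  finally show ?thesis
    using assms(3) by (simp add: zero_less_mult_iff)
next
  case False
  have "0 < (b - x) * w y"
    using assms(2)[of y] assms(3-) by simp
  also have "\<dots> \<le> (b - x) * w y + (x - y) * w b"
    using assms(2)[of b] assms(3,5,6) False by simp
  also have "\<dots> \<le> (b - y) * w x"
    using assms False by (intro concave_on_three_points[OF assms(1)]) auto
  finally show ?thesis
    using assms(3) by (simp add: zero_less_mult_iff)
qed

text \<open>Here \<open>r\<close> is the half-length and \<open>m\<close> the midpoint of the
  \<open>k\<close>-th subinterval. The two arguments differ by \<open>k * pi - pi / 2\<close>, and
  squaring removes the sign that depends on \<open>k\<close>.\<close>

lemma sin_shift_squared:
  assumes "a < b" "n \<ge> 1" "r = (b - a) / (2 * real n)" "m = a + (2 * real k - 1) * r"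
  shows "(sin (real n * pi * (x - a) / (b - a)))\<^sup>2 = (cos ((x - m) / r * pi / 2))\<^sup>2"
proof -
  have "r > 0"
    using assms(1-3) by simp
  have nr: "real n / (b - a) = 1 / (2 * r)"
    using assms(1,2) by (simp add: assms(3) divide_simps)
  have "real n * pi * (x - a) / (b - a) = real n / (b - a) * (x - a) * pi"
    by simp
  also have "\<dots> = ((x - m) / r * pi / 2 + real k * pi) - pi / 2"
    unfolding nr assms(4) using \<open>r > 0\<close> by (simp add: field_simps)
  finally show ?thesis
    by (simp add: sin_diff cos_add power_mult_distrib flip: power_mult)
qed

lemma equality_imp_sine_and_affine:
  fixes a b :: real and w f f' f'' :: "real \<Rightarrow> real"
  assumes "a < b"
    and w: "concave_on {a..b} w" "continuous_on {a..b} w" "\<And>x. x \<in> {a..b} \<Longrightarrow> 0 \<le> w x"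
      "\<And>x. a < x \<Longrightarrow> x < b \<Longrightarrow> 0 < w x"
    and f: "C2_with_derivs a b f f' f''" "f a = 0" "f b = 0"
    and nz: "\<exists>x\<in>{a..b}. f x \<noteq> 0"
    and int: "integral {a..b} (\<lambda>x. w x * (2 * ((f' x)\<^sup>2 + f x * f'' x))) = 0"
    and CS: "(integral {a..b} (\<lambda>x. w x * (f x * f'' x)))\<^sup>2
      = integral {a..b} (\<lambda>x. w x * (f x)\<^sup>2) * integral {a..b} (\<lambda>x. w x * (f'' x)\<^sup>2)"
    and P: "integral {a..b} (\<lambda>x. w x * (f x * f'' x)) \<le> 0"
  obtains c n where "n \<ge> 1" "\<forall>x\<in>{a..b}. f x = c * sin (real n * pi * (x - a) / (b - a))"
    "\<forall>k\<in>{1..n}. affine_fun_on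
       {a + (real k - 1) * (b - a) / real n .. a + real k * (b - a) / real n} w"
proof -
  note D = C2_with_derivsD[OF f(1)]
  \<comment> \<open>The weight is known to be positive only in the open interval, so the endpoint
    values of \<open>u\<close> come from continuity.\<close>
  have zero_of_int: "u x = 0"
    if "continuous_on {a..b} u" "integral {a..b} (\<lambda>x. w x * (u x)\<^sup>2) = 0" "x \<in> {a..b}"
    for u :: "real \<Rightarrow> real" and x
  proof -
    have "\<forall>x\<in>{a..b}. w x * (u x)\<^sup>2 = 0"
      using that(1,2) w(2,3) \<open>a < b\<close>
      by (subst integral_eq_0_iff[symmetric]) (auto intro!: continuous_intros)
    moreover have "w x \<noteq> 0" if "x \<in> {a<..<b}" for x
      using w(4)[of x] that by auto
    ultimately have "u x = 0" if "x \<in> {a<..<b}" for x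
      using that by (metis atLeastAtMost_iff greaterThanLessThan_iff less_imp_le mult_eq_0_iff power_eq_0_iff)
    then show ?thesis
      using continuous_constant_on_closure[of "{a<..<b}" u 0 x] that \<open>a < b\<close> by simp
  qed
  define B where "B = integral {a..b} (\<lambda>x. w x * (f x)\<^sup>2)"
  define C where "C = integral {a..b} (\<lambda>x. w x * (f'' x)\<^sup>2)"
  define Q where "Q = integral {a..b} (\<lambda>x. w x * (f x * f'' x))"
  have "B \<noteq> 0"
    using zero_of_int[of f] D nz unfolding B_def by auto
  moreover have "B \<ge> 0"
    unfolding B_def using w D by (intro integral_nonneg integrable_continuous_real continuous_intros) auto
  ultimately have "B > 0" by simp
  \<comment> \<open>This is the minimiser of the Cauchy-Schwarz quadratic; equality makes the
    minimum zero, which yields \<open>f'' = - t * f\<close>.\<close>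
  define t where "t = - Q / B"
  have "t \<ge> 0"
    using P \<open>B > 0\<close> by (simp add: t_def Q_def divide_nonpos_pos)
  have "C + 2 * t * Q + t\<^sup>2 * B = (B * C - Q\<^sup>2) / B"
    using \<open>B > 0\<close> by (simp add: t_def field_simps power2_eq_square)
  also have "\<dots> = 0"
    using CS by (simp add: B_def C_def Q_def)
  finally have "integral {a..b} (\<lambda>x. w x * (f'' x + t * f x)\<^sup>2) = 0"
    using integral_weighted_square_add[OF w(2) D(3) D(5), of t] by (simp add: B_def C_def Q_def)
  then have ode: "f'' x + t * f x = 0" if "x \<in> {a..b}" for x
    by (intro zero_of_int[of "\<lambda>x. f'' x + t * f x"] that continuous_intros D)
  \<comment> \<open>Otherwise \<open>f\<close> would be affine with two zeros, hence identically
    zero.\<close>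
  have "t \<noteq> 0"
  proof
    assume "t = 0"
    then have "(f' has_real_derivative 0) (at x within {a..b})" if "x \<in> {a..b}" for x
      using D(2)[OF that] ode[OF that] by simp
    then obtain m where m: "\<And>x. x \<in> {a..b} \<Longrightarrow> f' x = m"
      using has_field_derivative_zero_constant[of "{a..b}" f'] by auto
    have "((\<lambda>x. f x - m * x) has_real_derivative 0) (at x within {a..b})" if "x \<in> {a..b}" for x
      using D(1)[OF that] m[OF that] by (auto intro!: derivative_eq_intros)
    then obtain e where e: "\<And>x. x \<in> {a..b} \<Longrightarrow> f x - m * x = e"
      using has_field_derivative_zero_constant[of "{a..b}" "\<lambda>x. f x - m * x"] by auto
    have "- (m * a) = e" "- (m * b) = e"
      using e[of a] e[of b] f(2,3) \<open>a < b\<close> by simp_all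
    then have "m * a = m * b"
      by linarith
    then have "m = 0"
      using \<open>a < b\<close> by simp
    then have "\<forall>x\<in>{a..b}. f x = 0"
      using e[of a] e f \<open>a < b\<close> by simp
    then show False
      using nz by simp
  qed
  define \<kappa> where "\<kappa> = sqrt t"
  have \<kappa>: "\<kappa> > 0" "\<kappa>\<^sup>2 = t"
    using \<open>t \<ge> 0\<close> \<open>t \<noteq> 0\<close> by (simp_all add: \<kappa>_def)
  define c where "c = f' a / \<kappa>"
  have ode': "f'' x = - (\<kappa>\<^sup>2 * f x)" if "x \<in> {a..b}" for x
    using ode[OF that] \<kappa>(2) by simp
  have f_eq: "f x = c * sin (\<kappa> * (x - a))" if "x \<in> {a..b}" for x
    using oscillator_solution[OF f(1,2) _ ode' that] \<kappa>(1) by (simp add: c_def)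
  then have "c \<noteq> 0"
    using nz by auto
  \<comment> \<open>The boundary condition at \<open>b\<close> quantises the frequency:
    \<open>\<kappa> * (b - a)\<close> must be a positive multiple of \<open>pi\<close>.\<close>
  then have "sin (\<kappa> * (b - a)) = 0"
    using f_eq[of b] f(3) \<open>a < b\<close> by simp
  then obtain i :: int where i: "\<kappa> * (b - a) = of_int i * pi"
    by (auto simp: sin_zero_iff_int2)
  have "of_int i * pi > 0"
    using \<kappa>(1) \<open>a < b\<close> unfolding i[symmetric] by simp
  then have "i > 0"
    by (simp add: zero_less_mult_iff)
  define n where "n = nat i"
  have n: "n \<ge> 1" "\<kappa> * (b - a) = real n * pi"
    using \<open>i > 0\<close> i by (auto simp: n_def)
  have \<kappa>_eq: "\<kappa> = real n * pi / (b - a)"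
    using n(2) \<open>a < b\<close> by (simp add: field_simps)
  have f_sin: "f x = c * sin (real n * pi * (x - a) / (b - a))" if "x \<in> {a..b}" for x
    using f_eq[OF that] unfolding \<kappa>_eq by simp
  have "affine_fun_on {a + (real k - 1) * (b - a) / real n .. a + real k * (b - a) / real n} w"
    if k: "k \<in> {1..n}" for k
  proof -
    define r where "r = (b - a) / (2 * real n)"
    define m where "m = a + (2 * real k - 1) * r"
    have "r > 0"
      using \<open>a < b\<close> n(1) by (simp add: r_def)
    have nr: "b - a = 2 * real n * r" "(b - a) / real n = 2 * r"
      using n(1) by (simp_all add: r_def field_simps)
    have J: "m - r = a + (real k - 1) * ((b - a) / real n)" "m + r = a + real k * ((b - a) / real n)"
      unfolding nr(2) by (simp_all add: m_def algebra_simps)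
    have "(real k - 1) * (2 * r) \<ge> 0" "real k * (2 * r) \<le> real n * (2 * r)"
      using k \<open>r > 0\<close> by auto
    then have J_sub: "a \<le> m - r" "m + r \<le> b"
      unfolding J nr(2) using nr(1) by (simp_all add: algebra_simps)
    \<comment> \<open>The factor is chosen to cancel \<open>4 * r ^ 6\<close> from
      \<open>bump_le_cos_squared\<close>, leaving exactly the square of the amplitude times a
      squared cosine.\<close>
    have "c\<^sup>2 / (4 * r ^ 6) * bump m r x \<le> (f x)\<^sup>2" if x: "x \<in> {m - r..m + r}" for x
    proof -
      have "\<bar>x - m\<bar> \<le> r"
        using x by auto
      then have "c\<^sup>2 / (4 * r ^ 6) * bump m r x
          \<le> c\<^sup>2 / (4 * r ^ 6) * (4 * r ^ 6 * (cos ((x - m) / r * pi / 2))\<^sup>2)"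
        using \<open>r > 0\<close> by (intro mult_left_mono bump_le_cos_squared) auto
      also have "\<dots> = c\<^sup>2 * (cos ((x - m) / r * pi / 2))\<^sup>2"
        using \<open>r > 0\<close> by simp
      also have "\<dots> = (f x)\<^sup>2"
        using f_sin[of x] x J_sub sin_shift_squared[OF \<open>a < b\<close> n(1) r_def m_def, of x]
        by (simp add: power_mult_distrib)
      finally show ?thesis .
    qed
    then have "affine_fun_on {m - r..m + r} w"
      using \<open>c \<noteq> 0\<close> \<open>r > 0\<close> f(2,3)
      by (intro affine_of_integral_eq_0[OF \<open>a < b\<close> w(1-3) C2_with_derivs_square[OF f(1)] _ _ _ int _ J_sub,
            of "c\<^sup>2 / (4 * r ^ 6)"]) auto
    then show ?thesis
      unfolding J by simp
  qed
  with n(1) f_sin show thesis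
    by (intro that[of n c]) auto
qed

text \<open>The subintervals end at zeros of the sine, so on each of them the square of
  \<open>f\<close> and its derivative vanish at both ends, and affine pieces of \<open>w\<close>
  contribute nothing.\<close>

lemma sine_and_affine_imp_equality:
  fixes a b :: real and w f f' f'' :: "real \<Rightarrow> real"
  assumes "a < b" "continuous_on {a..b} w"
    and f: "C2_with_derivs a b f f' f''"
    and n: "n \<ge> 1" and f_sin: "\<forall>x\<in>{a..b}. f x = c * sin (real n * pi * (x - a) / (b - a))"
    and aff: "\<forall>k\<in>{1..n}. affine_fun_on
       {a + (real k - 1) * (b - a) / real n .. a + real k * (b - a) / real n} w"
  obtains t where "\<forall>x\<in>{a..b}. f'' x = t * f x"
    "integral {a..b} (\<lambda>x. w x * (2 * ((f' x)\<^sup>2 + f x * f'' x))) = 0"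
proof -
  define \<kappa> where "\<kappa> = real n * pi / (b - a)"
  have f_eq: "f x = c * sin (\<kappa> * (x - a))" if "x \<in> {a..b}" for x
    using f_sin that by (simp add: \<kappa>_def)
  have ode: "f'' x = - \<kappa>\<^sup>2 * f x" if "x \<in> {a..b}" for x
    using C2_with_derivs_unique(2)[OF \<open>a < b\<close> f C2_with_derivs_sin[of a b c \<kappa>] f_eq that] f_eq[OF that]
    by simp
  define g where "g x = w x * (2 * ((f' x)\<^sup>2 + f x * f'' x))" for x
  define x where "x i = a + real i * ((b - a) / real n)" for i
  have "mono x"
    unfolding mono_def x_def using \<open>a < b\<close> by (intro allI impI add_left_mono mult_right_mono) auto
  have x0: "x 0 = a" and xn: "x n = b"
    using n by (simp_all add: x_def)
  have x_in: "x i \<in> {a..b}" if "i \<le> n" for i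
    using monoD[OF \<open>mono x\<close>, of 0 i] monoD[OF \<open>mono x\<close>, of i n] that x0 xn by auto
  have fx: "f (x i) = 0" if "i \<le> n" for i
  proof -
    have "\<kappa> * (x i - a) = real i * pi"
      using n \<open>a < b\<close> by (simp add: \<kappa>_def x_def)
    then show ?thesis
      using f_eq[OF x_in[OF that]] by simp
  qed
  have "g integrable_on {x 0..x n}"
    unfolding x0 xn g_def using assms(2) C2_with_derivsD[OF f]
    by (intro integrable_continuous_real continuous_intros)
  then have "integral {a..b} g = (\<Sum>i<n. integral {x i..x (Suc i)} g)"
    using integral_sum_consecutive[OF \<open>mono x\<close>, of g n] by (simp add: x0 xn)
  also have "\<dots> = 0"
  proof (rule sum.neutral, rule ballI)
    fix i assume i: "i \<in> {..<n}"
    \<comment> \<open>The cells are numbered from 0 and the subintervals of the statement from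
      1.\<close>
    then have "Suc i \<in> {1..n}"
      by auto
    with aff have "affine_fun_on {a + (real (Suc i) - 1) * (b - a) / real n .. a + real (Suc i) * (b - a) / real n} w"
      by blast
    then have "affine_fun_on {x i..x (Suc i)} w"
      by (simp add: x_def)
    moreover have "{x i..x (Suc i)} \<subseteq> {a..b}"
      using x_in[of i] x_in[of "Suc i"] i by auto
    ultimately show "integral {x i..x (Suc i)} g = 0"
      unfolding g_def using fx[of i] fx[of "Suc i"] i monoD[OF \<open>mono x\<close>, of i "Suc i"]
      by (intro integral_affine_times_second_derivative_eq_0[OF _ _
            C2_with_derivs_subset[OF C2_with_derivs_square[OF f]]]) auto
  qed
  finally show thesis
    using that[of "- \<kappa>\<^sup>2"] ode unfolding g_def by blast
qed

section \<open>The inequality and its cases of equality\<close>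

theorem mainTheorem1:
  fixes a b :: real and w f f' f'' :: "real \<Rightarrow> real"
  assumes "a < b"
    and "concave_on {a..b} w"
    and "continuous_on {a..b} w"
    and "\<forall>x\<in>{a..b}. 0 \<le> w x"
    and "C2_with_derivs a b f f' f''"
    and "f a = 0" and "f b = 0"
  shows "(integral {a..b} (\<lambda>x. w x * (f' x)\<^sup>2))\<^sup>2
           \<le> integral {a..b} (\<lambda>x. w x * (f x)\<^sup>2) * integral {a..b} (\<lambda>x. w x * (f'' x)\<^sup>2)
       \<and> ((\<exists>x\<in>{a..b}. w x \<noteq> 0) \<longrightarrow> (\<exists>x\<in>{a..b}. f x \<noteq> 0) \<longrightarrow>
           ((integral {a..b} (\<lambda>x. w x * (f' x)\<^sup>2))\<^sup>2
              = integral {a..b} (\<lambda>x. w x * (f x)\<^sup>2) * integral {a..b} (\<lambda>x. w x * (f'' x)\<^sup>2)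
            \<longleftrightarrow> (\<exists>(c::real) (n::nat). n \<ge> 1
                  \<and> (\<forall>x\<in>{a..b}. f x = c * sin (real n * pi * (x - a) / (b - a)))
                  \<and> (\<forall>k\<in>{1..n}. affine_fun_on
                        {a + (real k - 1) * (b - a) / real n .. a + real k * (b - a) / real n} w))))"
proof -
  note D = C2_with_derivsD[OF assms(5)]
  define A where "A = integral {a..b} (\<lambda>x. w x * (f' x)\<^sup>2)"
  define B where "B = integral {a..b} (\<lambda>x. w x * (f x)\<^sup>2)"
  define C where "C = integral {a..b} (\<lambda>x. w x * (f'' x)\<^sup>2)"
  define Q where "Q = integral {a..b} (\<lambda>x. w x * (f x * f'' x))"
  define I where "I = integral {a..b} (\<lambda>x. w x * (2 * ((f' x)\<^sup>2 + f x * f'' x)))"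
  have w: "0 \<le> w x" if "x \<in> {a..b}" for x
    using assms(4) that by blast
  have "(\<lambda>x. w x * (2 * ((f' x)\<^sup>2 + f x * f'' x))) = (\<lambda>x. 2 * (w x * (f' x)\<^sup>2) + 2 * (w x * (f x * f'' x)))"
    by (simp add: algebra_simps)
  \<comment> \<open>\<open>I\<close> integrates \<open>w\<close> against the second derivative of
    the square of \<open>f\<close>, so its sign compares \<open>A\<close> with
    \<open>- Q\<close>.\<close>
  then have I: "I = 2 * (A + Q)"
    unfolding I_def A_def Q_def using assms(3) D
    by (simp add: integral_add integrable_continuous_real continuous_intros)
  have "I \<le> 0"
    unfolding I_def using assms(6,7)
    by (intro integral_concave_times_second_derivative_nonpos[OF assms(1-3) w C2_with_derivs_square[OF assms(5)]]) auto
  then have AQ: "A \<le> - Q"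
    unfolding I by simp
  have "A \<ge> 0"
    unfolding A_def using assms(3) w D
    by (intro integral_nonneg integrable_continuous_real continuous_intros) auto
  have "A\<^sup>2 \<le> (- Q)\<^sup>2"
    using AQ \<open>A \<ge> 0\<close> by (intro power_mono) auto
  then have AQ2: "A\<^sup>2 \<le> Q\<^sup>2"
    by simp
  have CS: "Q\<^sup>2 \<le> B * C"
    unfolding Q_def B_def C_def using assms(3) D w by (intro weighted_Cauchy_Schwarz_integral)
  let ?sine = "\<exists>(c::real) (n::nat). n \<ge> 1
    \<and> (\<forall>x\<in>{a..b}. f x = c * sin (real n * pi * (x - a) / (b - a)))
    \<and> (\<forall>k\<in>{1..n}. affine_fun_on
          {a + (real k - 1) * (b - a) / real n .. a + real k * (b - a) / real n} w)"
  have ?sine if wnz: "\<exists>x\<in>{a..b}. w x \<noteq> 0" and fnz: "\<exists>x\<in>{a..b}. f x \<noteq> 0" and eq: "A\<^sup>2 = B * C"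
  proof -
    \<comment> \<open>The chain from the square of \<open>A\<close> through that of \<open>Q\<close>
      to \<open>B * C\<close> collapses, so both estimates are equalities.\<close>
    have "Q\<^sup>2 = B * C" "Q\<^sup>2 = A\<^sup>2"
      using AQ2 CS eq by simp_all
    have "Q \<le> 0"
      using AQ \<open>A \<ge> 0\<close> by simp
    then have "Q = - A"
      using \<open>Q\<^sup>2 = A\<^sup>2\<close> \<open>A \<ge> 0\<close> unfolding power2_eq_iff by auto
    then have "I = 0"
      by (simp add: I)
    obtain y where y: "y \<in> {a..b}" "w y \<noteq> 0"
      using wnz by blast
    have pos: "0 < w x" if "a < x" "x < b" for x
      using concave_on_pos_interior[OF assms(2) w y that] .
    obtain c n where sol: "n \<ge> 1" "\<forall>x\<in>{a..b}. f x = c * sin (real n * pi * (x - a) / (b - a))"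
      "\<forall>k\<in>{1..n}. affine_fun_on
         {a + (real k - 1) * (b - a) / real n .. a + real k * (b - a) / real n} w"
      by (rule equality_imp_sine_and_affine[OF assms(1-3) w pos assms(5-7) fnz \<open>I = 0\<close>[unfolded I_def]
        \<open>Q\<^sup>2 = B * C\<close>[unfolded Q_def B_def C_def] \<open>Q \<le> 0\<close>[unfolded Q_def]])
    show ?thesis
      by (rule exI[of _ c], rule exI[of _ n]) (intro conjI sol)
  qed
  moreover have "A\<^sup>2 = B * C" if sine: ?sine
  proof -
    from sine obtain c n where "n \<ge> 1" "\<forall>x\<in>{a..b}. f x = c * sin (real n * pi * (x - a) / (b - a))"
      "\<forall>k\<in>{1..n}. affine_fun_on
         {a + (real k - 1) * (b - a) / real n .. a + real k * (b - a) / real n} w"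
      by (elim exE conjE)
    then obtain t where ode: "\<forall>x\<in>{a..b}. f'' x = t * f x" and "I = 0"
      unfolding I_def by (rule sine_and_affine_imp_equality[OF assms(1,3,5)])
    \<comment> \<open>Since \<open>f''\<close> is \<open>t\<close> times \<open>f\<close>, both
      \<open>Q\<close> and \<open>C\<close> become multiples of \<open>B\<close>, and with
      \<open>A = - Q\<close> both sides equal \<open>t\<^sup>2 * B\<^sup>2\<close>.\<close>
    have "Q = integral {a..b} (\<lambda>x. t * (w x * (f x)\<^sup>2))"
      unfolding Q_def using ode by (intro integral_cong) (simp add: power2_eq_square)
    then have "Q = t * B"
      by (simp add: B_def)
    have "C = integral {a..b} (\<lambda>x. t\<^sup>2 * (w x * (f x)\<^sup>2))"
      unfolding C_def using ode by (intro integral_cong) (simp add: power_mult_distrib)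
    then have "C = t\<^sup>2 * B"
      by (simp add: B_def)
    have "A = - Q"
      using \<open>I = 0\<close> by (simp add: I)
    then show ?thesis
      using \<open>Q = t * B\<close> \<open>C = t\<^sup>2 * B\<close> by (simp add: power2_eq_square)
  qed
  moreover have "A\<^sup>2 \<le> B * C"
    using AQ2 CS by simp
  ultimately show ?thesis
    unfolding A_def B_def C_def by blast
qed

end
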